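(* Let $G$ be a finite group and let $\vartheta,\psi: G\to \mathrm{M}(n,\mathbb{C})$ be two different but equivalent, unitary, irreducible matrix representations of $G$ of dimension $n$. Then: 1) There exist indices $a,b\in\{1,\ldots,n\}$ such that $$\sum_{g\in G}\vartheta_{aa}(g)\,\psi_{bb}(g^{-1})>0$$ (i.e. this sum is a positive real number). 2) For every pair of indices $(a,b)$ such that the sum in 1) is positive, put $$r_{ab}=\sqrt{\frac{n}{|G|}}\left(\sum_{g\in G}\vartheta_{aa}(g)\,\psi_{bb}(g^{-1})\right)^{1/2}>0 .$$ Then the matrix $U=(u_{ij})\in \mathrm{M}(n,\mathbb{C})$ with entries $$u_{ij}\equiv u_{ij}(ab)=\frac{1}{r_{ab}}\,\frac{n}{|G|}\sum_{g\in G}\overline{\vartheta_{ai}(g)}\,\psi_{bj}(g)$$ is unitary and determines the similarity transformation between $\vartheta$ and $\psi$: $$U^{\dagger}\vartheta(g)U=\psi(g)\qquad\text{for all } g\in G .$$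
   Context: For a matrix representation $\vartheta$, $\vartheta_{ij}(g)$ denotes the $(i,j)$ entry of the matrix $\vartheta(g)$; the bar denotes complex conjugation; $U^\dagger$ is the conjugate transpose. Two representations $\vartheta,\psi: G\to \mathrm{GL}(n,\mathbb{C})$ are equivalent if there exists $X\in\mathrm{GL}(n,\mathbb{C})$ with $X^{-1}\vartheta(g)X=\psi(g)$ for all $g\in G$. A matrix representation is unitary if every $\vartheta(g)$ is a unitary matrix. *)

theory Defs
  imports "HOL-Analysis.Analysis" "HOL-Algebra.Group"
begin

definition GL :: "(complex ^ 'n ^ 'n) monoid" where
  "GL = \<lparr>carrier = {A. invertible A}, monoid.mult = (**), one = mat 1\<rparr>"

definition adjoint_matrix :: "complex ^ 'n ^ 'm \<Rightarrow> complex ^ 'm ^ 'n" where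
  "adjoint_matrix A = (\<chi> i j. cnj (A $ j $ i))"

definition unitary_matrix :: "complex ^ 'n ^ 'n \<Rightarrow> bool" where
  "unitary_matrix A \<longleftrightarrow>
     adjoint_matrix A ** A = mat 1 \<and> A ** adjoint_matrix A = mat 1"

(* A representation is a total function on the element type; only its values on
   the carrier of G are meaningful, and every notion below is relativised to it. *)

definition matrix_rep :: "('g, 'x) monoid_scheme \<Rightarrow> ('g \<Rightarrow> complex ^ 'n ^ 'n) \<Rightarrow> bool" where
  "matrix_rep G \<theta> \<longleftrightarrow> \<theta> \<in> hom G GL"

definition unitary_rep :: "('g, 'x) monoid_scheme \<Rightarrow> ('g \<Rightarrow> complex ^ 'n ^ 'n) \<Rightarrow> bool" where
  "unitary_rep G \<theta> \<longleftrightarrow> matrix_rep G \<theta> \<and> (\<forall>g\<in>carrier G. unitary_matrix (\<theta> g))"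

(* "vec.subspace" is the complex-linear notion; the unqualified "subspace" would
   be the real-linear one. The space is nonzero since index types are nonempty. *)

definition irreducible_rep :: "('g, 'x) monoid_scheme \<Rightarrow> ('g \<Rightarrow> complex ^ 'n ^ 'n) \<Rightarrow> bool" where
  "irreducible_rep G \<theta> \<longleftrightarrow> matrix_rep G \<theta> \<and>
     (\<forall>W. vec.subspace W \<and> (\<forall>g\<in>carrier G. \<forall>w\<in>W. \<theta> g *v w \<in> W) \<longrightarrow>
          W = {0} \<or> W = UNIV)"

definition equivalent_reps ::
  "('g, 'x) monoid_scheme \<Rightarrow> ('g \<Rightarrow> complex ^ 'n ^ 'n) \<Rightarrow> ('g \<Rightarrow> complex ^ 'n ^ 'n) \<Rightarrow> bool" where
  "equivalent_reps G \<theta> \<psi> \<longleftrightarrow>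
     (\<exists>X. invertible X \<and> (\<forall>g\<in>carrier G. matrix_inv X ** \<theta> g ** X = \<psi> g))"

definition diag_sum ::
  "('g, 'x) monoid_scheme \<Rightarrow> ('g \<Rightarrow> complex ^ 'n ^ 'n) \<Rightarrow> ('g \<Rightarrow> complex ^ 'n ^ 'n) \<Rightarrow> 'n \<Rightarrow> 'n \<Rightarrow> complex" where
  "diag_sum G \<theta> \<psi> a b = (\<Sum>g\<in>carrier G. \<theta> g $ a $ a * \<psi> (inv\<^bsub>G\<^esub> g) $ b $ b)"

definition positive_real :: "complex \<Rightarrow> bool" where
  "positive_real z \<longleftrightarrow> z \<in> \<real> \<and> Re z > 0"

(* Only used when diag_sum is a positive real, so that it equals its real part. *)

definition r_coeff ::
  "('g, 'x) monoid_scheme \<Rightarrow> ('g \<Rightarrow> complex ^ 'n ^ 'n) \<Rightarrow> ('g \<Rightarrow> complex ^ 'n ^ 'n) \<Rightarrow> 'n \<Rightarrow> 'n \<Rightarrow> real" where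
  "r_coeff G \<theta> \<psi> a b =
     sqrt (real CARD('n) / real (card (carrier G))) * sqrt (Re (diag_sum G \<theta> \<psi> a b))"

definition U_matrix ::
  "('g, 'x) monoid_scheme \<Rightarrow> ('g \<Rightarrow> complex ^ 'n ^ 'n) \<Rightarrow> ('g \<Rightarrow> complex ^ 'n ^ 'n) \<Rightarrow> 'n \<Rightarrow> 'n \<Rightarrow> complex ^ 'n ^ 'n" where
  "U_matrix G \<theta> \<psi> a b = (\<chi> i j.
     1 / of_real (r_coeff G \<theta> \<psi> a b) * (of_nat CARD('n) / of_nat (card (carrier G))) *
     (\<Sum>g\<in>carrier G. cnj (\<theta> g $ a $ i) * \<psi> g $ b $ j))"

end

(* Write \<theta>(g) X = X \<psi>(g). The average A of \<theta>(g)* E_ab \<psi>(g) over G also intertwines \<theta> and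
   \<psi>, so Schur's lemma gives A = \<lambda> X and X* X = \<mu> I. Comparing the traces of X* A yields
   \<lambda> = |G| cnj(X_ab) / (\<mu> n), hence the diagonal sum, which is cnj(A_ab), equals
   |G| |X_ab|^2 / (\<mu> n). It is positive exactly when X_ab is nonzero, and U is the multiple of X
   normalised by U* U = I. *)
theory Submission
  imports Defs "HOL-Computational_Algebra.Fundamental_Theorem_Algebra"
begin

section \<open>Scalar matrices and adjoints\<close>

lemma mat_matrix_mult_nth:
  fixes A :: "'a::comm_semiring_1 ^ 'm ^ 'n"
  shows "(mat c ** A) $ i $ j = c * A $ i $ j"
  by (auto simp: matrix_matrix_mult_def mat_def if_distrib if_distribR cong: if_cong)

lemma matrix_mult_mat_commute:
  fixes A :: "'a::comm_semiring_1 ^ 'm ^ 'n"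
  shows "A ** mat c = mat c ** A"
  by (auto simp: vec_eq_iff matrix_matrix_mult_def mat_def if_distrib if_distribR mult.commute
      cong: if_cong)

lemma mat_matrix_vector_mult: "mat c *v v = c *s (v :: 'a::comm_semiring_1 ^ 'n)"
  by (auto simp: vec_eq_iff matrix_vector_mult_def mat_def if_distrib if_distribR cong: if_cong)

lemma mat_mult_mat: "mat c ** mat d = (mat (c * d) :: 'a::comm_semiring_1 ^ 'n ^ 'n)"
  by (simp add: vec_eq_iff mat_matrix_mult_nth) (simp add: mat_def)

lemma trace_mat_mult:
  fixes A :: "'a::comm_semiring_1 ^ 'n ^ 'n"
  shows "trace (mat c ** A) = c * trace A"
  by (simp add: trace_def mat_matrix_mult_nth sum_distrib_left)

lemma matrix_mult_add_rdistrib: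
  fixes A B :: "'a::semiring_1 ^ 'n ^ 'm"
  shows "(A + B) ** C = A ** C + B ** C"
  by (simp add: vec_eq_iff matrix_matrix_mult_def distrib_right sum.distrib)

lemma matrix_mult_sum_left:
  fixes A :: "'a::semiring_1 ^ 'n ^ 'm"
  shows "A ** (\<Sum>x\<in>S. f x) = (\<Sum>x\<in>S. A ** f x)"
  by (induction S rule: infinite_finite_induct) (simp_all add: matrix_add_ldistrib)

lemma matrix_mult_sum_right:
  fixes A :: "'a::semiring_1 ^ 'n ^ 'm"
  shows "(\<Sum>x\<in>S. f x) ** A = (\<Sum>x\<in>S. f x ** A)"
  by (induction S rule: infinite_finite_induct) (simp_all add: matrix_mult_add_rdistrib)

lemma trace_sum: "trace (\<Sum>x\<in>S. f x) = (\<Sum>x\<in>S. trace (f x))"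
  unfolding trace_def by (simp add: sum.swap[of _ _ S])

lemma adjoint_matrix_mult: "adjoint_matrix (A ** B) = adjoint_matrix B ** adjoint_matrix A"
  by (simp add: adjoint_matrix_def matrix_matrix_mult_def vec_eq_iff cnj_sum mult.commute)

lemma adjoint_matrix_adjoint [simp]: "adjoint_matrix (adjoint_matrix A) = A"
  by (simp add: adjoint_matrix_def vec_eq_iff)

lemma adjoint_matrix_mat [simp]: "adjoint_matrix (mat c) = mat (cnj c)"
  by (simp add: adjoint_matrix_def vec_eq_iff mat_def)

section \<open>Eigenvalues and Schur's lemma\<close>

lemma ex_eigenvector:
  fixes M :: "complex ^ 'n ^ 'n"
  obtains c v where "v \<noteq> 0" "M *v v = c *s v"
proof -
  \<comment> \<open>With polynomial entries, \<open>det P\<close> is the characteristic polynomial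
    of \<open>M\<close> as a genuine \<open>poly\<close>, so the fundamental theorem of algebra
    applies to it.\<close>
  define P :: "complex poly ^ 'n ^ 'n" where "P = (\<chi> i j. monom (mat 1 $ i $ j) 1 - [:M $ i $ j:])"
  have P_nth: "poly (P $ i $ j) z = (mat z - M) $ i $ j" for i j z
    by (simp add: P_def mat_def poly_monom)
  have poly_P: "poly (det P) z = det (mat z - M)" for z
    by (simp add: det_def poly_sum poly_prod P_nth of_int_poly)
  have "\<exists>z. det (mat z - M) = 0"
  proof (rule ccontr)
    assume no_root: "\<nexists>z. det (mat z - M) = 0"
    then have "constant (poly (det P))"
      using fundamental_theorem_of_algebra[of "det P"] poly_P by auto
    then obtain c where c: "det (mat z - M) = c" for z
      unfolding constant_def by (metis poly_P)
    \<comment> \<open>A root-free characteristic polynomial is constant; dividing it by \<open>z ^ CARD('n)\<close> and letting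
      \<open>z = 1 / t k\<close> tend to infinity gives \<open>det (mat 1) = 0\<close>.\<close>
    define t :: "nat \<Rightarrow> complex" where "t k = inverse (of_nat (Suc k))" for k
    have t0: "t \<longlonglongrightarrow> 0"
      unfolding t_def using lim_inverse_n by (rule LIMSEQ_Suc)
    have "det (mat 1 - mat (t k) ** M) = t k ^ CARD('n) * c" for k
    proof -
      have "t k * of_nat (Suc k) = 1"
        by (simp add: t_def del: of_nat_Suc)
      then have "mat 1 - mat (t k) ** M = mat (t k) ** (mat (of_nat (Suc k)) - M)"
        by (simp add: vec_eq_iff mat_matrix_mult_nth)
           (simp add: mat_def right_diff_distrib del: of_nat_Suc)
      moreover have "det (mat (t k) :: complex ^ 'n ^ 'n) = t k ^ CARD('n)"
        by (subst det_diagonal) (auto simp: mat_def)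
      ultimately show ?thesis by (simp add: det_mul c del: of_nat_Suc)
    qed
    moreover have "(\<lambda>k. t k ^ CARD('n) * c) \<longlonglongrightarrow> 0 ^ CARD('n) * c"
      by (intro tendsto_intros t0)
    \<comment> \<open>Expanding \<open>det\<close> leaves finite sums and products of entries that
      are affine in \<open>t k\<close>, so the limit can be taken entry by entry.\<close>
    moreover have "(\<lambda>k. det (mat 1 - mat (t k) ** M)) \<longlonglongrightarrow> det (mat 1 - mat 0 ** M)"
      unfolding det_def vector_minus_component mat_matrix_mult_nth by (intro tendsto_intros t0)
    ultimately have "det (mat 1 - mat 0 ** M) = 0 ^ CARD('n) * c"
      using LIMSEQ_unique by fastforce
    moreover have "mat 1 - mat 0 ** M = mat 1"
      by (simp add: vec_eq_iff mat_matrix_mult_nth)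
    \<comment> \<open>Index types are nonempty, so \<open>0 ^ CARD('n)\<close> vanishes, whereas the
      identity has determinant 1.\<close>
    ultimately show False by (simp add: power_0_left)
  qed
  then obtain z where "\<not> invertible (mat z - M)"
    by (auto simp: invertible_det_nz)
  then obtain v where "v \<noteq> 0" "(mat z - M) *v v = 0"
    using invertible_left_inverse matrix_left_invertible_ker by blast
  then show thesis
    using that[of v z] by (simp add: matrix_vector_mult_diff_rdistrib mat_matrix_vector_mult)
qed

text \<open>An eigenspace of \<open>M\<close> is nonzero and invariant under every
  \<open>\<psi> g\<close>, so irreducibility makes it the whole space.\<close>

lemma schur_scalar:
  assumes "irreducible_rep G \<psi>"
    and comm: "\<And>g. g \<in> carrier G \<Longrightarrow> M ** \<psi> g = \<psi> g ** M"
  obtains c where "M = mat c"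
proof -
  obtain c v where v: "v \<noteq> 0" "M *v v = c *s v"
    by (rule ex_eigenvector)
  define W where "W = {w. M *v w = c *s w}"
  have "vec.subspace W"
    by (auto simp: W_def vec.subspace_def matrix_vector_right_distrib vector_add_ldistrib
        vector_scalar_commute mult.commute)
  moreover have "\<psi> g *v w \<in> W" if "g \<in> carrier G" "w \<in> W" for g w
  proof -
    have "M *v (\<psi> g *v w) = \<psi> g *v (M *v w)"
      by (simp add: matrix_vector_mul_assoc comm that)
    then show ?thesis using that by (simp add: W_def vector_scalar_commute)
  qed
  ultimately have "W = UNIV"
    using assms(1) v unfolding irreducible_rep_def W_def by blast
  then have "M *v w = mat c *v w" for w
    by (auto simp: W_def mat_matrix_vector_mult)
  then have "M = mat c" by (simp add: matrix_eq)
  then show thesis by (rule that)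
qed

section \<open>Unitary representations and intertwiners\<close>

lemma unitary_rep_mult:
  assumes "unitary_rep G \<theta>" "g \<in> carrier G" "h \<in> carrier G"
  shows "\<theta> (g \<otimes>\<^bsub>G\<^esub> h) = \<theta> g ** \<theta> h"
  using assms by (auto simp: unitary_rep_def matrix_rep_def hom_def GL_def)

lemma unitary_rep_adjoint_cancel:
  assumes "unitary_rep G \<theta>" "g \<in> carrier G"
  shows "adjoint_matrix (\<theta> g) ** \<theta> g = mat 1" "\<theta> g ** adjoint_matrix (\<theta> g) = mat 1"
  using assms by (auto simp: unitary_rep_def unitary_matrix_def)

lemma unitary_rep_inv:
  assumes "group G" "unitary_rep G \<theta>" "g \<in> carrier G"
  shows "\<theta> (inv\<^bsub>G\<^esub> g) = adjoint_matrix (\<theta> g)"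
proof -
  interpret group G by fact
  \<comment> \<open>The second factor \<open>\<theta> g\<close> stands in for the fact that the unit
    is sent to \<open>mat 1\<close>: multiplying twice by the adjoint on the right leaves
    \<open>\<theta>\<close> of the inverse on one side and the adjoint on the other.\<close>
  have "\<theta> (inv\<^bsub>G\<^esub> g) ** \<theta> g ** \<theta> g = \<theta> g"
    using assms by (simp flip: unitary_rep_mult)
  then have "\<theta> (inv\<^bsub>G\<^esub> g) ** (\<theta> g ** adjoint_matrix (\<theta> g)) ** (\<theta> g ** adjoint_matrix (\<theta> g))
      = \<theta> g ** adjoint_matrix (\<theta> g) ** adjoint_matrix (\<theta> g)"
    using unitary_rep_adjoint_cancel[OF assms(2,3)]
    by (metis matrix_mul_assoc matrix_mul_rid)
  then show ?thesis
    using unitary_rep_adjoint_cancel[OF assms(2,3)] by simp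
qed

text \<open>Take adjoints in the relation for the inverse of \<open>g\<close>; by unitarity, the
  adjoint of the value at the inverse is the value at \<open>g\<close>.\<close>

lemma adjoint_intertwines:
  assumes "group G" "unitary_rep G \<theta>" "unitary_rep G \<psi>"
    and X: "\<And>g. g \<in> carrier G \<Longrightarrow> \<theta> g ** X = X ** \<psi> g" and g: "g \<in> carrier G"
  shows "adjoint_matrix X ** \<theta> g = \<psi> g ** adjoint_matrix X"
proof -
  interpret group G by fact
  have "adjoint_matrix (\<theta> (inv\<^bsub>G\<^esub> g) ** X) = adjoint_matrix (X ** \<psi> (inv\<^bsub>G\<^esub> g))"
    using X g by simp
  then show ?thesis using assms by (simp add: adjoint_matrix_mult unitary_rep_inv)
qed

text \<open>The product commutes with every \<open>\<psi> g\<close>, hence is scalar by Schur. Each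
  of its diagonal entries is the squared norm of a column of \<open>X\<close>, and an invertible
  matrix has no zero column.\<close>

lemma intertwiner_adjoint_mult_scalar:
  fixes X :: "complex ^ 'n ^ 'n"
  assumes "group G" "unitary_rep G \<theta>" "unitary_rep G \<psi>" "irreducible_rep G \<psi>"
    and "invertible X" and X: "\<And>g. g \<in> carrier G \<Longrightarrow> \<theta> g ** X = X ** \<psi> g"
  obtains \<mu> :: real where "\<mu> > 0" "adjoint_matrix X ** X = mat (of_real \<mu>)"
proof -
  have "adjoint_matrix X ** X ** \<psi> g = \<psi> g ** (adjoint_matrix X ** X)" if "g \<in> carrier G" for g
    using adjoint_intertwines[OF assms(1-3) X that] X[OF that] by (metis matrix_mul_assoc)
  then obtain m where m: "adjoint_matrix X ** X = mat m"
    using schur_scalar[OF assms(4)] by metis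
  fix i :: 'n
  define \<mu> where "\<mu> = (\<Sum>k\<in>UNIV. (cmod (X $ k $ i))\<^sup>2)"
  have "m = (adjoint_matrix X ** X) $ i $ i" by (simp add: m mat_def)
  also have "\<dots> = of_real \<mu>"
    by (simp add: \<mu>_def matrix_matrix_mult_def adjoint_matrix_def mult.commute
        flip: complex_norm_square)
  finally have m_eq: "m = of_real \<mu>" .
  have "\<mu> \<noteq> 0"
  proof
    assume "\<mu> = 0"
    then have "X $ k $ i = 0" for k
      by (simp add: \<mu>_def sum_nonneg_eq_0_iff)
    then have "(Y ** X) $ i $ i = 0" for Y :: "complex ^ 'n ^ 'n"
      by (simp add: matrix_matrix_mult_def)
    moreover obtain Y where "Y ** X = mat 1"
      using assms(5) by (auto simp: invertible_def)
    ultimately have "(mat 1 :: complex ^ 'n ^ 'n) $ i $ i = 0" by metis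
    then show False by (simp add: mat_def)
  qed
  moreover have "\<mu> \<ge> 0" by (simp add: \<mu>_def sum_nonneg)
  ultimately show thesis using that[of \<mu>] m m_eq by simp
qed

text \<open>Averaging over the group, up to the factor 1/|G|. The adjoint takes the place of the
  inverse so that the entries show the conjugates occurring in \<open>U_matrix\<close>.\<close>

definition average ::
  "('g, 'x) monoid_scheme \<Rightarrow> ('g \<Rightarrow> complex ^ 'n ^ 'n) \<Rightarrow> ('g \<Rightarrow> complex ^ 'n ^ 'n)
    \<Rightarrow> complex ^ 'n ^ 'n \<Rightarrow> complex ^ 'n ^ 'n" where
  "average G \<theta> \<psi> E = (\<Sum>g\<in>carrier G. adjoint_matrix (\<theta> g) ** E ** \<psi> g)"

lemma average_intertwines:
  assumes "group G" "unitary_rep G \<theta>" "unitary_rep G \<psi>" and h: "h \<in> carrier G"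
  shows "\<theta> h ** average G \<theta> \<psi> E = average G \<theta> \<psi> E ** \<psi> h"
proof -
  interpret group G by fact
  have "\<theta> h ** average G \<theta> \<psi> E = (\<Sum>g\<in>carrier G. \<theta> h ** adjoint_matrix (\<theta> g) ** E ** \<psi> g)"
    by (simp add: average_def matrix_mult_sum_left matrix_mul_assoc)
  also have "\<dots> = (\<Sum>g\<in>carrier G. adjoint_matrix (\<theta> g) ** E ** \<psi> g ** \<psi> h)"
  \<comment> \<open>Right translation: \<open>g\<close> is replaced by \<open>g\<close> times the
    inverse of \<open>h\<close>, which releases \<open>\<theta> h\<close> on the left and absorbs
    \<open>\<psi> h\<close> on the right.\<close>
  proof (rule sum.reindex_bij_witness[of _ "\<lambda>g. g \<otimes>\<^bsub>G\<^esub> h" "\<lambda>g. g \<otimes>\<^bsub>G\<^esub> inv\<^bsub>G\<^esub> h"])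
    fix g assume g: "g \<in> carrier G"
    have "adjoint_matrix (\<theta> (g \<otimes>\<^bsub>G\<^esub> inv\<^bsub>G\<^esub> h)) = \<theta> h ** adjoint_matrix (\<theta> g)"
      using assms g by (simp add: unitary_rep_mult unitary_rep_inv adjoint_matrix_mult)
    moreover have "\<psi> (g \<otimes>\<^bsub>G\<^esub> inv\<^bsub>G\<^esub> h) ** \<psi> h = \<psi> g"
      using assms g by (simp add: m_assoc flip: unitary_rep_mult)
    ultimately show "adjoint_matrix (\<theta> (g \<otimes>\<^bsub>G\<^esub> inv\<^bsub>G\<^esub> h)) ** E ** \<psi> (g \<otimes>\<^bsub>G\<^esub> inv\<^bsub>G\<^esub> h) ** \<psi> h
        = \<theta> h ** adjoint_matrix (\<theta> g) ** E ** \<psi> g"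
      by (metis matrix_mul_assoc)
  qed (use h in \<open>auto simp: m_assoc\<close>)
  also have "\<dots> = average G \<theta> \<psi> E ** \<psi> h"
    by (simp add: average_def matrix_mult_sum_right)
  finally show ?thesis .
qed

text \<open>Every summand has the same trace: cyclicity brings \<open>\<psi> g\<close> to the front,
  and moving it past the adjoint of \<open>X\<close> turns it into \<open>\<theta> g\<close>, which
  cancels its adjoint.\<close>

lemma trace_adjoint_mult_average:
  assumes "group G" "unitary_rep G \<theta>" "unitary_rep G \<psi>"
    and X: "\<And>g. g \<in> carrier G \<Longrightarrow> \<theta> g ** X = X ** \<psi> g"
  shows "trace (adjoint_matrix X ** average G \<theta> \<psi> E)
    = of_nat (card (carrier G)) * trace (adjoint_matrix X ** E)"
proof -
  have "trace (adjoint_matrix X ** (adjoint_matrix (\<theta> g) ** E ** \<psi> g)) = trace (adjoint_matrix X ** E)"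
    if g: "g \<in> carrier G" for g
  proof -
    have "trace (adjoint_matrix X ** (adjoint_matrix (\<theta> g) ** E ** \<psi> g))
        = trace (\<psi> g ** adjoint_matrix X ** adjoint_matrix (\<theta> g) ** E)"
      by (metis trace_mul_sym matrix_mul_assoc)
    also have "\<psi> g ** adjoint_matrix X ** adjoint_matrix (\<theta> g)
        = adjoint_matrix X ** (\<theta> g ** adjoint_matrix (\<theta> g))"
      using adjoint_intertwines[OF assms g] by (simp add: matrix_mul_assoc)
    finally show ?thesis using unitary_rep_adjoint_cancel[OF assms(2) g] by simp
  qed
  then show ?thesis by (simp add: average_def matrix_mult_sum_left trace_sum)
qed

lemma average_eq_scalar_mult:
  fixes \<theta> \<psi> :: "'g \<Rightarrow> complex ^ 'n ^ 'n"
  assumes "group G" "unitary_rep G \<theta>" "unitary_rep G \<psi>" "irreducible_rep G \<psi>"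
    and X: "\<And>g. g \<in> carrier G \<Longrightarrow> \<theta> g ** X = X ** \<psi> g"
    and \<mu>: "adjoint_matrix X ** X = mat \<mu>" "\<mu> \<noteq> 0"
  shows "average G \<theta> \<psi> E
    = mat (of_nat (card (carrier G)) * trace (adjoint_matrix X ** E) / (\<mu> * of_nat CARD('n))) ** X"
proof -
  define A where "A = average G \<theta> \<psi> E"
  \<comment> \<open>\<open>A\<close> and the adjoint of \<open>X\<close> intertwine in opposite
    directions, so their product commutes with \<open>\<psi>\<close> and Schur's lemma
    applies.\<close>
  have "adjoint_matrix X ** A ** \<psi> g = \<psi> g ** (adjoint_matrix X ** A)" if "g \<in> carrier G" for g
    using adjoint_intertwines[OF assms(1-3) X that] average_intertwines[OF assms(1-3) that, of E]
    by (metis matrix_mul_assoc A_def)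
  then obtain l where l: "adjoint_matrix X ** A = mat l"
    using schur_scalar[OF assms(4)] by metis
  \<comment> \<open>Up to the factor \<open>\<mu>\<close>, the adjoint of \<open>X\<close> is its
    inverse, so \<open>A\<close> can be recovered from the scalar \<open>l\<close>.\<close>
  have "mat (1 / \<mu>) ** adjoint_matrix X ** X = mat 1"
    using \<mu> by (simp add: mat_mult_mat flip: matrix_mul_assoc)
  then have inv: "X ** (mat (1 / \<mu>) ** adjoint_matrix X) = mat 1"
    using matrix_left_right_inverse by blast
  have "A = X ** (mat (1 / \<mu>) ** adjoint_matrix X) ** A" by (simp add: inv)
  also have "\<dots> = X ** mat (l / \<mu>)"
    using l by (simp add: mat_mult_mat flip: matrix_mul_assoc)
  finally have A: "A = mat (l / \<mu>) ** X" by (simp add: matrix_mult_mat_commute)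
  have "l * of_nat CARD('n) = trace (adjoint_matrix X ** A)"
    by (simp add: l trace_def mat_def)
  also have "\<dots> = of_nat (card (carrier G)) * trace (adjoint_matrix X ** E)"
    unfolding A_def by (rule trace_adjoint_mult_average[OF assms(1-3) X])
  finally have "l = of_nat (card (carrier G)) * trace (adjoint_matrix X ** E) / of_nat CARD('n)"
    by (simp add: field_simps)
  then show ?thesis using A by (simp add: A_def mult.commute)
qed

section \<open>The matrix of coefficient sums\<close>

definition unit_matrix :: "'n \<Rightarrow> 'm \<Rightarrow> complex ^ 'm ^ 'n" where
  "unit_matrix a b = (\<chi> i j. if i = a \<and> j = b then 1 else 0)"

lemma mult_unit_matrix_nth:
  "(A ** unit_matrix a b) $ i $ j = (if j = b then A $ i $ a else 0)"
  by (auto simp: matrix_matrix_mult_def unit_matrix_def if_distrib if_distribR cong: if_cong)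

text \<open>A matrix unit between two factors picks out one column times one row; this turns entries
  of \<open>average\<close> into sums of products of coefficients.\<close>

lemma mult_unit_matrix_mult_nth:
  "(A ** unit_matrix a b ** B) $ i $ j = A $ i $ a * B $ b $ j"
proof -
  have "(A ** unit_matrix a b ** B) $ i $ j
      = (\<Sum>k\<in>UNIV. (A ** unit_matrix a b) $ i $ k * B $ k $ j)"
    by (simp add: matrix_matrix_mult_def)
  also have "\<dots> = (\<Sum>k\<in>UNIV. if k = b then A $ i $ a * B $ k $ j else 0)"
    unfolding mult_unit_matrix_nth by (intro sum.cong) auto
  finally show ?thesis by simp
qed

lemma average_unit_matrix_nth:
  "average G \<theta> \<psi> (unit_matrix a b) $ i $ j = (\<Sum>g\<in>carrier G. cnj (\<theta> g $ a $ i) * \<psi> g $ b $ j)"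
  by (simp add: average_def mult_unit_matrix_mult_nth) (simp add: adjoint_matrix_def)

lemma trace_adjoint_mult_unit_matrix:
  "trace (adjoint_matrix X ** unit_matrix a b) = cnj (X $ a $ b)"
  unfolding trace_def mult_unit_matrix_nth by (simp add: adjoint_matrix_def)

text \<open>By unitarity, \<open>\<psi>\<close> at an inverse has the conjugate diagonal entries, so
  conjugating the average moves the bar from \<open>\<theta>\<close> to
  \<open>\<psi>\<close>.\<close>

lemma diag_sum_eq_average:
  assumes "group G" "unitary_rep G \<psi>"
  shows "diag_sum G \<theta> \<psi> a b = cnj (average G \<theta> \<psi> (unit_matrix a b) $ a $ b)"
  using assms
  by (simp add: diag_sum_def average_unit_matrix_nth unitary_rep_inv adjoint_matrix_def)

lemma U_matrix_eq_average:
  fixes \<theta> \<psi> :: "'g \<Rightarrow> complex ^ 'n ^ 'n"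
  shows "U_matrix G \<theta> \<psi> a b
    = mat (of_nat CARD('n) / (of_real (r_coeff G \<theta> \<psi> a b) * of_nat (card (carrier G))))
      ** average G \<theta> \<psi> (unit_matrix a b)"
  by (simp add: vec_eq_iff mat_matrix_mult_nth average_unit_matrix_nth U_matrix_def)

theorem mainTheorem1:
  fixes G :: "('g, 'x) monoid_scheme"
    and \<theta> \<psi> :: "'g \<Rightarrow> complex ^ 'n ^ 'n"
  assumes "group G" and "finite (carrier G)"
    and "unitary_rep G \<theta>" and "irreducible_rep G \<theta>"
    and "unitary_rep G \<psi>" and "irreducible_rep G \<psi>"
    and "equivalent_reps G \<theta> \<psi>"
    and "\<exists>g\<in>carrier G. \<theta> g \<noteq> \<psi> g"
  shows "(\<exists>a b. positive_real (diag_sum G \<theta> \<psi> a b)) \<and>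
    (\<forall>a b. positive_real (diag_sum G \<theta> \<psi> a b) \<longrightarrow>
       r_coeff G \<theta> \<psi> a b > 0 \<and>
       unitary_matrix (U_matrix G \<theta> \<psi> a b) \<and>
       (\<forall>g\<in>carrier G.
          adjoint_matrix (U_matrix G \<theta> \<psi> a b) ** \<theta> g ** U_matrix G \<theta> \<psi> a b = \<psi> g))"
proof -
  interpret group G by fact
  define N where "N = card (carrier G)"
  have N: "N > 0" using assms(2) by (auto simp: N_def card_gt_0_iff)
  obtain X where "invertible X" and X': "\<And>g. g \<in> carrier G \<Longrightarrow> matrix_inv X ** \<theta> g ** X = \<psi> g"
    using assms(7) unfolding equivalent_reps_def by blast
  \<comment> \<open>\<open>matrix_inv\<close> is a \<open>SOME\<close> term, so its defining
    property comes from the existence of an inverse.\<close>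
  have X_inv: "X ** matrix_inv X = mat 1"
    using someI_ex[OF \<open>invertible X\<close>[unfolded invertible_def]] by (simp add: matrix_inv_def)
  have X: "\<theta> g ** X = X ** \<psi> g" if "g \<in> carrier G" for g
    using X_inv X'[OF that]
    by (metis matrix_mul_assoc matrix_mul_lid)
  obtain \<mu> :: real where \<mu>: "\<mu> > 0" and XX: "adjoint_matrix X ** X = mat (of_real \<mu>)"
    using intertwiner_adjoint_mult_scalar[OF assms(1,3,5,6) \<open>invertible X\<close> X] by metis
  have avg: "average G \<theta> \<psi> (unit_matrix a b)
      = mat (of_nat N * cnj (X $ a $ b) / (of_real \<mu> * of_nat CARD('n))) ** X" for a b
    using average_eq_scalar_mult[OF assms(1,3,5,6) X XX] \<mu>
    by (simp add: trace_adjoint_mult_unit_matrix N_def)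
  have ds: "diag_sum G \<theta> \<psi> a b = of_real (N * (cmod (X $ a $ b))\<^sup>2 / (\<mu> * CARD('n)))" for a b
    unfolding diag_sum_eq_average[OF assms(1,5)] avg mat_matrix_mult_nth
    by (simp add: mult.assoc flip: complex_norm_square)
  \<comment> \<open>By \<open>ds\<close> every diagonal sum is a nonnegative real, so positivity
    amounts to being nonzero.\<close>
  have pos_iff: "positive_real (diag_sum G \<theta> \<psi> a b) \<longleftrightarrow> X $ a $ b \<noteq> 0" for a b
    unfolding ds positive_real_def Re_complex_of_real
    using N \<mu> by (simp add: zero_less_divide_iff zero_less_mult_iff)
  have "X \<noteq> 0"
  proof
    assume "X = 0"
    then have "(X ** matrix_inv X) $ i $ i = 0" for i
      by (simp add: matrix_matrix_mult_def)
    then show False by (simp add: X_inv mat_def)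
  qed
  then have "\<exists>a b. positive_real (diag_sum G \<theta> \<psi> a b)"
    by (simp add: pos_iff vec_eq_iff)
  moreover have "r_coeff G \<theta> \<psi> a b > 0 \<and> unitary_matrix (U_matrix G \<theta> \<psi> a b) \<and>
      (\<forall>g\<in>carrier G. adjoint_matrix (U_matrix G \<theta> \<psi> a b) ** \<theta> g ** U_matrix G \<theta> \<psi> a b = \<psi> g)"
    if "positive_real (diag_sum G \<theta> \<psi> a b)" for a b
  proof -
    define U where "U = U_matrix G \<theta> \<psi> a b"
    define x where "x = X $ a $ b"
    have x: "x \<noteq> 0" using that by (simp add: pos_iff x_def)
    have r: "r_coeff G \<theta> \<psi> a b = cmod x / sqrt \<mu>"
      unfolding r_coeff_def ds Re_complex_of_real x_def[symmetric] N_def[symmetric]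
      using N \<mu> by (simp add: real_sqrt_divide real_sqrt_mult)
    \<comment> \<open>This is the scalar n/(r |G|) of \<open>U_matrix\<close> times the scalar |G|
      cnj(x)/(\<mu> n) of \<open>avg\<close>, with \<open>r\<close> inserted: a phase divided by
      \<open>sqrt \<mu>\<close>.\<close>
    define k where "k = cnj x / of_real (cmod x * sqrt \<mu>)"
    have U: "U = mat k ** X"
    proof -
      have "of_real \<mu> = (of_real (sqrt \<mu>) * of_real (sqrt \<mu>) :: complex)"
        using \<mu> by (simp flip: of_real_mult)
      then show ?thesis
        unfolding U_def U_matrix_eq_average avg r k_def x_def[symmetric] N_def[symmetric]
        using N \<mu> x by (simp add: matrix_mul_assoc mat_mult_mat)
    qed
    have "cnj k * k * of_real \<mu> = 1"
    proof -
      have "cnj k * k = of_real ((cmod k)\<^sup>2)"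
        by (metis complex_norm_square mult.commute)
      also have "(cmod k)\<^sup>2 = 1 / \<mu>"
        using \<mu> x by (simp add: k_def norm_divide norm_mult power_divide power_mult_distrib)
      finally show ?thesis using \<mu> by simp
    qed
    moreover have "adjoint_matrix U ** U = mat (cnj k * k) ** (adjoint_matrix X ** X)"
      unfolding U adjoint_matrix_mult adjoint_matrix_mat
      by (metis mat_mult_mat matrix_mul_assoc matrix_mult_mat_commute mult.commute)
    ultimately have UU: "adjoint_matrix U ** U = mat 1"
      by (simp add: XX mat_mult_mat)
    then have "U ** adjoint_matrix U = mat 1"
      using matrix_left_right_inverse by blast
    moreover have "adjoint_matrix U ** \<theta> g ** U = \<psi> g" if "g \<in> carrier G" for g
    proof -
      \<comment> \<open>A scalar multiple of an intertwiner intertwines; multiplying by the adjoint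
        of \<open>U\<close> on the left then isolates \<open>\<psi> g\<close>.\<close>
      have "\<theta> g ** U = U ** \<psi> g"
        unfolding U using X[OF that] by (metis matrix_mul_assoc matrix_mult_mat_commute)
      then show ?thesis using UU by (metis matrix_mul_assoc matrix_mul_lid)
    qed
    ultimately show ?thesis
      using UU x \<mu> r by (simp add: unitary_matrix_def U_def)
  qed
  ultimately show ?thesis by blast
qed

end
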